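(* Let $\Sigma$ be an alphabet, let $w\in\mathbb{Z}_+$, let $F:\Sigma^{\mathbb{Z}}\to\Sigma^{\mathbb{Z}}$ be a cellular automaton that is rapidly left expansive with width $w$, and let $x\in\mathcal{N}(\Sigma)$ be a number-like configuration. Then for every $i\in\mathbb{Z}$ the trace $\operatorname{Tr}_{[i,i+w-1]}(x)$ (with respect to $F$) is not eventually periodic.
   Context: $\mathbb{N}=\{0,1,2,\dots\}$ and $\mathbb{Z}_+=\{1,2,\dots\}$. An alphabet is a finite set $\Sigma=\{0,1,\dots,n-1\}$ with $n\in\mathbb{Z}_+$. Elements of $\Sigma^{\mathbb{Z}}$ are called configurations; $x[i]$ is the value of $x$ at $i$; $0^{\mathbb{Z}}$ is the all-zero configuration. A map $F:\Sigma^{\mathbb{Z}}\to\Sigma^{\mathbb{Z}}$ is a cellular automaton (CA) if there are $m,n\in\mathbb{N}$ and $f:\Sigma^{m+n+1}\to\Sigma$ with $F(x)[i]=f(x[i-m],\dots,x[i],\dots,x[i+n])$ for all $x\in\Sigma^{\mathbb{Z}}$, $i\in\mathbb{Z}$. A configuration $x\neq 0^{\mathbb{Z}}$ is number-like if there is $N\in\mathbb{Z}$ with $x[i]=0$ for all $i<N$; its left edge $\ell(x)$ is the least $N\in\mathbb{Z}$ with $x[N]\neq 0$. $\mathcal{N}(\Sigma)$ is the set of number-like configurations over $\Sigma$. The space-time diagram of $x\in\Sigma^{\mathbb{Z}}$ with respect to $F$ is $\theta\in\Sigma^{\mathbb{Z}\times(-\mathbb{N})}$, $\theta[(i,j)]=F^{-j}(x)[i]$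 for $i\in\mathbb{Z}$, $j\le 0$. For $h,d\in\mathbb{N}$, $w\in\mathbb{Z}_+$ let $R(h,d,w)=\{(i,j)\in\mathbb{Z}^2\mid 0\le i<w,\ -d\le j\le h\}$. $F$ is left expansive with dimensions $(h,d,w)$ if, with $R=R(h,d,w)$, for all space-time diagrams $\theta_1,\theta_2$ with respect to $F$ and all $(i_1,j_1),(i_2,j_2)\in\mathbb{Z}^2$ with $(i_1,j_1)+R,\ (i_2,j_2)+R\subseteq\mathbb{Z}\times(-\mathbb{N})$: if $\theta_1[(i_1,j_1)+\rho]=\theta_2[(i_2,j_2)+\rho]$ for all $\rho\in R$, then $\theta_1[(i_1-1,j_1)]=\theta_2[(i_2-1,j_2)]$. $F$ is left spreading if $F(0^{\mathbb{Z}})=0^{\mathbb{Z}}$ and for each $x\in\mathcal{N}(\Sigma)$ there is $t\in\mathbb{Z}_+$ such that $\ell(F^t(x))<\ell(x)$ (in particular $F^t(x)\neq 0^{\mathbb{Z}}$). The spreading speed of a left spreading $F$ is $\sup_{x\in\mathcal{N}(\Sigma)}\limsup_{t\to\infty}\frac{-\ell(F^t(x))}{t}$. $F$ is rapidly left expansive with width $w\in\mathbb{Z}_+$ if there are $h,d\in\mathbb{N}$ such that $F$ is left expansive with dimensions $(h,d,w)$, $F$ is left spreading with spreading speed $s$, and $s<1/h$ (with the convention $1/0=\infty$). For integers $i\le j$, the trace $\operatorname{Tr}_{[i,j]}(x)$ with respect to $F$ is the one-sided sequence over the alphabet $\Sigma^{j-i+1}$ given by $\operatorname{Tr}_{[i,j]}(x)[t]=F^t(x)[i]F^t(x)[i+1]\cdots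 F^t(x)[j]$ for $t\in\mathbb{N}$. A one-sided sequence $y$ indexed by $\mathbb{N}$ is eventually periodic if there are $p\in\mathbb{Z}_+$ and $c\in\mathbb{N}$ with $y[t+p]=y[t]$ for all $t\ge c$. *)

theory Defs
  imports Complex_Main "HOL-Library.FuncSet" "HOL-Library.Product_Plus"
    "HOL-Library.Extended_Real"
begin

(* The alphabet of size n is {..<n}. A configuration is a function int => nat taking values
   in the alphabet. A map on configurations is an HOL function on all of int => nat, but every
   notion below refers only to its values on configs n. *)

definition configs :: "nat \<Rightarrow> (int \<Rightarrow> nat) set" where
  "configs n = UNIV \<rightarrow> {..<n}"

definition zero_config :: "int \<Rightarrow> nat" where
  "zero_config = (\<lambda>_. 0)"

(* The local rule f is a map from words of length m + k + 1 over the alphabet to the alphabet;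
   map x [i - m..i + k] is the word x[i-m] ... x[i+k]. *)
definition cellular_automaton :: "nat \<Rightarrow> ((int \<Rightarrow> nat) \<Rightarrow> (int \<Rightarrow> nat)) \<Rightarrow> bool" where
  "cellular_automaton n F \<longleftrightarrow>
     (\<exists>(m::nat) (k::nat) (f :: nat list \<Rightarrow> nat).
        f \<in> {u. length u = m + k + 1 \<and> set u \<subseteq> {..<n}} \<rightarrow> {..<n} \<and>
        (\<forall>x\<in>configs n. \<forall>i. F x i = f (map x [i - int m..i + int k])))"

definition number_like :: "nat \<Rightarrow> (int \<Rightarrow> nat) set" where
  "number_like n = {x \<in> configs n. x \<noteq> zero_config \<and> (\<exists>N. \<forall>i<N. x i = 0)}"

(* Meaningful only for number-like x, where the least such N exists. *)
definition left_edge :: "(int \<Rightarrow> nat) \<Rightarrow> int" where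
  "left_edge x = (LEAST N. x N \<noteq> 0)"

(* Meaningful only at points (i, j) with j \<le> 0. *)
definition spacetime :: "((int \<Rightarrow> nat) \<Rightarrow> (int \<Rightarrow> nat)) \<Rightarrow> (int \<Rightarrow> nat) \<Rightarrow> int \<times> int \<Rightarrow> nat" where
  "spacetime F x = (\<lambda>(i, j). (F ^^ nat (- j)) x i)"

definition rect :: "nat \<Rightarrow> nat \<Rightarrow> nat \<Rightarrow> (int \<times> int) set" where
  "rect h d w = {(i, j). 0 \<le> i \<and> i < int w \<and> - int d \<le> j \<and> j \<le> int h}"

definition left_expansive ::
  "nat \<Rightarrow> ((int \<Rightarrow> nat) \<Rightarrow> (int \<Rightarrow> nat)) \<Rightarrow> nat \<Rightarrow> nat \<Rightarrow> nat \<Rightarrow> bool" where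
  "left_expansive n F h d w \<longleftrightarrow>
     (\<forall>\<theta>1 \<in> spacetime F ` configs n. \<forall>\<theta>2 \<in> spacetime F ` configs n. \<forall>p1 p2 :: int \<times> int.
        (\<lambda>\<rho>. p1 + \<rho>) ` rect h d w \<subseteq> UNIV \<times> {..0} \<longrightarrow>
        (\<lambda>\<rho>. p2 + \<rho>) ` rect h d w \<subseteq> UNIV \<times> {..0} \<longrightarrow>
        (\<forall>\<rho> \<in> rect h d w. \<theta>1 (p1 + \<rho>) = \<theta>2 (p2 + \<rho>)) \<longrightarrow>
        \<theta>1 (p1 - (1, 0)) = \<theta>2 (p2 - (1, 0)))"

(* Membership of the iterate in number_like makes its left edge well defined. *)
definition left_spreading :: "nat \<Rightarrow> ((int \<Rightarrow> nat) \<Rightarrow> (int \<Rightarrow> nat)) \<Rightarrow> bool" where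
  "left_spreading n F \<longleftrightarrow>
     F zero_config = zero_config \<and>
     (\<forall>x \<in> number_like n. \<exists>t>0. (F ^^ t) x \<in> number_like n \<and>
        left_edge ((F ^^ t) x) < left_edge x)"

(* For a left spreading cellular automaton every iterate of a number-like x is number-like,
   so all left edges below are well defined. The value at t = 0 is irrelevant to the limsup. *)
definition spreading_speed :: "nat \<Rightarrow> ((int \<Rightarrow> nat) \<Rightarrow> (int \<Rightarrow> nat)) \<Rightarrow> ereal" where
  "spreading_speed n F =
     (SUP x \<in> number_like n.
        limsup (\<lambda>t. ereal (real_of_int (- left_edge ((F ^^ t) x)) / real t)))"

definition rapidly_left_expansive ::
  "nat \<Rightarrow> ((int \<Rightarrow> nat) \<Rightarrow> (int \<Rightarrow> nat)) \<Rightarrow> nat \<Rightarrow> bool" where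
  "rapidly_left_expansive n F w \<longleftrightarrow>
     (\<exists>h d. left_expansive n F h d w \<and> left_spreading n F \<and>
        spreading_speed n F < (if h = 0 then \<infinity> else ereal (1 / real h)))"

definition trace ::
  "((int \<Rightarrow> nat) \<Rightarrow> (int \<Rightarrow> nat)) \<Rightarrow> int \<Rightarrow> int \<Rightarrow> (int \<Rightarrow> nat) \<Rightarrow> nat \<Rightarrow> nat list" where
  "trace F i j x t = map ((F ^^ t) x) [i..j]"

definition eventually_periodic :: "(nat \<Rightarrow> 'a) \<Rightarrow> bool" where
  "eventually_periodic y \<longleftrightarrow> (\<exists>p>0. \<exists>c. \<forall>t\<ge>c. y (t + p) = y t)"

end

theory Submission
  imports Defs
begin

text \<open>
  Suppose that the trace of width \<open>w\<close> at column \<open>i\<close> has period \<open>p\<close> from time \<open>c\<close> on. Left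
  expansivity reads the value of a cell off the window of width \<open>w\<close> to its right, looking back
  \<open>h\<close> steps in time and forward \<open>d\<close> steps. Hence periodicity passes from a window to the column
  on its left with the same period \<open>p\<close>, only \<open>h\<close> steps later, and column \<open>i - k\<close> has period \<open>p\<close>
  from time \<open>c + k * h\<close> on (\<open>periodicity_moves_left\<close>). The front of this periodic region moves
  left by one column every \<open>h\<close> steps, with speed \<open>1 / h\<close>.

  The left edge of the orbit is slower than that, so for all large \<open>k\<close> column \<open>i - k\<close> is still
  zero during the whole first period after time \<open>c + k * h\<close> (\<open>left_edge_lags\<close>). By periodicity
  it then remains zero at all later times. So every column far enough to the left is zero at all
  times, whereas a left spreading automaton pushes the left edge beyond every column
  (\<open>left_edge_unbounded\<close>).
\<close>

lemma funpow_in_configs: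
  assumes "cellular_automaton n F" "x \<in> configs n"
  shows "(F ^^ t) x \<in> configs n"
proof (induction t)
  case (Suc t)
  obtain m k f where f: "f \<in> {u. length u = m + k + 1 \<and> set u \<subseteq> {..<n}} \<rightarrow> {..<n}"
    and F: "\<And>x i. x \<in> configs n \<Longrightarrow> F x i = f (map x [i - int m..i + int k])"
    using assms(1) unfolding cellular_automaton_def by blast
  let ?y = "(F ^^ t) x"
  have "F ?y i < n" for i
  proof -
    have "map ?y [i - int m..i + int k] \<in> {u. length u = m + k + 1 \<and> set u \<subseteq> {..<n}}"
      using Suc by (auto simp: configs_def)
    then show ?thesis
      using f unfolding F[OF Suc] by blast
  qed
  then show ?case by (simp add: configs_def)
qed (use assms in simp)

text \<open>At a cell whose whole neighbourhood is zero the local rule gives what it gives on the zero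
  configuration, so one step moves the bound by at most the right radius of the rule.\<close>

lemma iterates_zero_on_left:
  assumes "cellular_automaton n F" "F zero_config = zero_config"
    and "x \<in> configs n" "\<forall>i<N. x i = 0"
  shows "\<exists>M. \<forall>i<M. (F ^^ t) x i = 0"
proof (induction t)
  case 0
  then show ?case using assms(4) by auto
next
  case (Suc t)
  obtain m k f where
    F: "\<And>x i. x \<in> configs n \<Longrightarrow> F x i = f (map x [i - int m..i + int k])"
    using assms(1) unfolding cellular_automaton_def by blast
  have "0 < n" using assms(3) by (auto simp: configs_def Pi_iff)
  then have zero: "zero_config \<in> configs n"
    by (auto simp: configs_def zero_config_def)
  let ?y = "(F ^^ t) x"
  obtain M where M: "\<forall>i<M. ?y i = 0" using Suc by blast
  have "F ?y i = 0" if "i < M - int k" for i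
  proof -
    have "map ?y [i - int m..i + int k] = map zero_config [i - int m..i + int k]"
      using M that by (auto simp: zero_config_def)
    then have "F ?y i = F zero_config i"
      unfolding F[OF funpow_in_configs[OF assms(1,3)]] F[OF zero] by (rule arg_cong)
    then show ?thesis using assms(2) by (simp add: zero_config_def)
  qed
  then show ?case by auto
qed

lemma left_edge_least:
  assumes "y a \<noteq> 0" "\<forall>i<N. y i = 0"
  shows "y (left_edge y) \<noteq> 0 \<and> (\<forall>i<left_edge y. y i = 0)"
proof -
  \<comment> \<open>The integers are not well-ordered, so the search is made over the offsets from \<open>N\<close>.\<close>
  define k where "k = (LEAST k::nat. y (N + int k) \<noteq> 0)"
  have "N \<le> a" using assms by (meson not_le)
  then have "y (N + int (nat (a - N))) \<noteq> 0" using assms(1) by simp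
  then have k: "y (N + int k) \<noteq> 0"
    unfolding k_def by (rule LeastI)
  have below: "y i = 0" if "i < N + int k" for i
  proof (cases "i < N")
    case False
    then have "nat (i - N) < k" using that by linarith
    then have "\<not> y (N + int (nat (i - N))) \<noteq> 0"
      unfolding k_def by (rule not_less_Least)
    then show ?thesis using False by simp
  qed (use assms(2) in simp)
  have "left_edge y = N + int k"
    unfolding left_edge_def
  proof (rule Least_equality)
    show "N + int k \<le> j" if "y j \<noteq> 0" for j
      using that below by (meson not_le)
  qed (fact k)
  then show ?thesis using k below by simp
qed

lemma zero_before_left_edge:
  assumes "\<forall>i<N. y i = 0" "i < left_edge y"
  shows "y i = 0"
  using left_edge_least[OF _ assms(1)] assms(2) by blast

text \<open>Left spreading only promises one step to the left, but it can be applied again to the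
  iterate that it provides, and each application gains at least one column.\<close>

lemma left_edge_unbounded:
  assumes "left_spreading n F" "x \<in> number_like n"
  shows "\<exists>t. \<exists>i<N. (F ^^ t) x i \<noteq> 0"
proof -
  have steps: "\<exists>t. (F ^^ t) x \<in> number_like n \<and> left_edge ((F ^^ t) x) \<le> left_edge x - int k"
    for k
  proof (induction k)
    case 0
    show ?case using assms(2) by (intro exI[of _ 0]) simp
  next
    case (Suc k)
    then obtain t where t: "(F ^^ t) x \<in> number_like n"
      "left_edge ((F ^^ t) x) \<le> left_edge x - int k" by blast
    then obtain t' where "(F ^^ t') ((F ^^ t) x) \<in> number_like n"
      "left_edge ((F ^^ t') ((F ^^ t) x)) < left_edge ((F ^^ t) x)"
      using assms(1) unfolding left_spreading_def by blast
    then show ?case using t(2)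
      by (intro exI[of _ "t' + t"]) (simp add: funpow_add)
  qed
  obtain t where t: "(F ^^ t) x \<in> number_like n"
    "left_edge ((F ^^ t) x) \<le> left_edge x - int (nat (left_edge x - N + 1))"
    using steps by blast
  then obtain a M where "(F ^^ t) x a \<noteq> 0" "\<forall>i<M. (F ^^ t) x i = 0"
    by (auto simp: number_like_def zero_config_def fun_eq_iff)
  from left_edge_least[of "(F ^^ t) x", OF this]
  have "(F ^^ t) x (left_edge ((F ^^ t) x)) \<noteq> 0" by simp
  moreover have "left_edge ((F ^^ t) x) < N" using t(2) by linarith
  ultimately show ?thesis by blast
qed

text \<open>The two occurrences of the rectangle are placed in the same space-time diagram, \<open>p\<close> steps
  apart. Looking back \<open>h\<close> steps is what delays the onset of periodicity by \<open>h\<close>.\<close>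

lemma periodicity_moves_left:
  assumes exp: "left_expansive n F h d w" and x: "x \<in> configs n"
    and per: "\<And>t j. c \<le> t \<Longrightarrow> i \<le> j \<Longrightarrow> j < i + int w \<Longrightarrow> (F ^^ (t + p)) x j = (F ^^ t) x j"
  shows "c + k * h \<le> t \<Longrightarrow> i - int k \<le> j \<Longrightarrow> j < i + int w \<Longrightarrow>
    (F ^^ (t + p)) x j = (F ^^ t) x j"
proof (induction k arbitrary: t j)
  case 0
  then show ?case using per by simp
next
  case (Suc k)
  show ?case
  proof (cases "j = i - int (Suc k)")
    case False
    then show ?thesis using Suc.prems by (intro Suc.IH) auto
  next
    case True
    let ?\<theta> = "spacetime F x"
    let ?p1 = "(i - int k, - int (t + p))" and ?p2 = "(i - int k, - int t)"
    have "h \<le> t" using Suc.prems(1) by simp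
    then have sub: "(\<lambda>\<rho>. ?p1 + \<rho>) ` rect h d w \<subseteq> UNIV \<times> {..0}"
      "(\<lambda>\<rho>. ?p2 + \<rho>) ` rect h d w \<subseteq> UNIV \<times> {..0}"
      by (auto simp: rect_def)
    have eq: "?\<theta> (?p1 + \<rho>) = ?\<theta> (?p2 + \<rho>)" if \<rho>: "\<rho> \<in> rect h d w" for \<rho>
    proof -
      obtain a b where ab: "\<rho> = (a, b)" "0 \<le> a" "a < int w" "- int d \<le> b" "b \<le> int h"
        using \<rho> by (auto simp: rect_def)
      define s where "s = nat (int t - b)"
      have "int c + int k * int h + int h \<le> int t"
        using Suc.prems(1) by (simp flip: of_nat_mult of_nat_add add: algebra_simps)
      then have "int (c + k * h) \<le> int s" using ab(5) by (simp add: s_def)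
      then have "c + k * h \<le> s" by (simp only: of_nat_le_iff)
      then have "(F ^^ (s + p)) x (i - int k + a) = (F ^^ s) x (i - int k + a)"
        using ab(2,3) by (intro Suc.IH) auto
      moreover have "nat (int p + int t - b) = s + p"
        using ab(5) \<open>h \<le> t\<close> by (simp add: s_def)
      ultimately show ?thesis
        by (simp add: spacetime_def ab(1) s_def)
    qed
    have "?\<theta> (?p1 - (1, 0)) = ?\<theta> (?p2 - (1, 0))"
      using exp[unfolded left_expansive_def, rule_format,
        OF imageI[OF x] imageI[OF x] sub] eq by blast
    then show ?thesis
      unfolding True by (simp add: spacetime_def nat_add_distrib algebra_simps flip: of_nat_add)
  qed
qed

text \<open>The left edge eventually moves at a speed \<open>a\<close> with \<open>a * h < 1\<close>, and its finitely many
  earlier positions only contribute a bounded error. For \<open>h = 0\<close> the speed does not matter: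
  only the finitely many times up to \<open>b\<close> occur.\<close>

lemma left_edge_lags:
  assumes ca: "cellular_automaton n F" and spr: "left_spreading n F"
    and speed: "spreading_speed n F < (if h = 0 then \<infinity> else ereal (1 / real h))"
    and x: "x \<in> number_like n"
  shows "\<exists>K. \<forall>k\<ge>K. \<forall>t\<le>b + k * h. (F ^^ t) x (i - int k) = 0"
proof -
  have "\<exists>M. \<forall>i<M. (F ^^ t) x i = 0" for t
    using iterates_zero_on_left[OF ca] spr x
    unfolding left_spreading_def number_like_def by blast
  then obtain M where M: "\<And>t i. i < M t \<Longrightarrow> (F ^^ t) x i = 0" by metis
  have initial: "\<exists>m. \<forall>t\<le>T. \<forall>i<m. (F ^^ t) x i = 0" for T
  proof (intro exI[of _ "Min (M ` {..T})"] allI impI)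
    fix t i assume "t \<le> T" "i < Min (M ` {..T})"
    then have "i < M t" by auto
    then show "(F ^^ t) x i = 0" by (rule M)
  qed
  show ?thesis
  proof (cases "h = 0")
    case True
    obtain m where m: "\<forall>t\<le>b. \<forall>i<m. (F ^^ t) x i = 0" using initial by blast
    show ?thesis
      using m True by (intro exI[of _ "nat (i - m + 1)"]) auto
  next
    case False
    let ?v = "\<lambda>t. ereal (real_of_int (- left_edge ((F ^^ t) x)) / real t)"
    have "limsup ?v \<le> spreading_speed n F"
      unfolding spreading_speed_def using x by (rule SUP_upper)
    also have "\<dots> < ereal (1 / real h)" using speed False by simp
    finally have "max 0 (limsup ?v) < ereal (1 / real h)"
      using False by simp
    then obtain a where a: "max 0 (limsup ?v) < ereal a" "ereal a < ereal (1 / real h)"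
      using ereal_dense2 by blast
    have "0 < a" using a(1) by simp
    have ah: "a * real h < 1" using a(2) False by (simp add: field_simps)
    have "eventually (\<lambda>t. ?v t < ereal a) sequentially"
      using a(1) by (intro Limsup_lessD) simp
    then obtain T where T: "\<And>t. T \<le> t \<Longrightarrow> ?v t < ereal a"
      unfolding eventually_sequentially by blast
    obtain m where m: "\<forall>t\<le>T. \<forall>i<m. (F ^^ t) x i = 0" using initial by blast
    have late: "(F ^^ t) x j = 0" if "T < t" "real_of_int j < - a * real t" for t j
    proof (rule zero_before_left_edge)
      show "\<forall>i<M t. (F ^^ t) x i = 0" using M by blast
      have "real_of_int (- left_edge ((F ^^ t) x)) < a * real t"
        using T[of t] that(1) by (simp add: field_simps)
      then show "j < left_edge ((F ^^ t) x)" using that(2) by simp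
    qed
    \<comment> \<open>\<open>K\<close> is chosen such that \<open>i - k < - a * (b + k * h)\<close> for all \<open>k \<ge> K\<close>.\<close>
    define K where
      "K = max (nat (i - m + 1)) (nat \<lceil>(real_of_int i + a * real b) / (1 - a * real h)\<rceil> + 1)"
    have "(F ^^ t) x (i - int k) = 0" if k: "K \<le> k" and t: "t \<le> b + k * h" for k t
    proof (cases "t \<le> T")
      case True
      have "i - int k < m" using k unfolding K_def by linarith
      then show ?thesis using m True by blast
    next
      case False
      have "(real_of_int i + a * real b) / (1 - a * real h) < real k"
        using k unfolding K_def by linarith
      then have "real_of_int i + a * real b < real k * (1 - a * real h)"
        using ah by (simp add: field_simps)
      then have "real_of_int (i - int k) < - a * real (b + k * h)"
        by (simp add: algebra_simps)
      also have "\<dots> \<le> - a * real t"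
        using t \<open>0 < a\<close> by (simp del: of_nat_add of_nat_mult)
      finally show ?thesis using False by (intro late) auto
    qed
    then show ?thesis by blast
  qed
qed

lemma periodic_zero_period_imp_zero:
  fixes g :: "nat \<Rightarrow> nat"
  assumes "p > 0" and per: "\<And>t. c \<le> t \<Longrightarrow> g (t + p) = g t"
    and zero: "\<And>t. t \<le> c + p \<Longrightarrow> g t = 0"
  shows "g t = 0"
proof (induction t rule: less_induct)
  case (less t)
  show ?case
  proof (cases "t \<le> c + p")
    case False
    then have "g t = g (t - p)" using per[of "t - p"] by simp
    then show ?thesis using less[of "t - p"] False \<open>p > 0\<close> by simp
  qed (rule zero)
qed

theorem theorem3p5:
  fixes n w :: nat
    and F :: "(int \<Rightarrow> nat) \<Rightarrow> (int \<Rightarrow> nat)"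
    and x :: "int \<Rightarrow> nat"
  assumes "n \<ge> 1"
    and "w \<ge> 1"
    and "cellular_automaton n F"
    and "rapidly_left_expansive n F w"
    and "x \<in> number_like n"
  shows "\<forall>i::int. \<not> eventually_periodic (trace F i (i + int w - 1) x)"
proof (intro allI notI)
  fix i :: int
  assume "eventually_periodic (trace F i (i + int w - 1) x)"
  then obtain p c where "p > 0"
    and tr: "\<And>t. c \<le> t \<Longrightarrow>
      trace F i (i + int w - 1) x (t + p) = trace F i (i + int w - 1) x t"
    unfolding eventually_periodic_def by blast
  have window: "(F ^^ (t + p)) x j = (F ^^ t) x j"
    if "c \<le> t" "i \<le> j" "j < i + int w" for t j
    using tr[OF that(1)] that(2,3) by (auto simp: trace_def)
  obtain h d where exp: "left_expansive n F h d w" and spr: "left_spreading n F"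
    and speed: "spreading_speed n F < (if h = 0 then \<infinity> else ereal (1 / real h))"
    using assms(4) unfolding rapidly_left_expansive_def by blast
  have x: "x \<in> configs n" using assms(5) by (simp add: number_like_def)
  obtain K where K: "\<And>k t. K \<le> k \<Longrightarrow> t \<le> c + p + k * h \<Longrightarrow> (F ^^ t) x (i - int k) = 0"
    using left_edge_lags[OF assms(3) spr speed assms(5)] by blast
  have "(F ^^ t) x (i - int k) = 0" if "K \<le> k" for k t
  proof (rule periodic_zero_period_imp_zero[where
        g = "\<lambda>t. (F ^^ t) x (i - int k)" and c = "c + k * h", OF \<open>p > 0\<close>])
    show "(F ^^ (t + p)) x (i - int k) = (F ^^ t) x (i - int k)" if "c + k * h \<le> t" for t
      using periodicity_moves_left[OF exp x window that] assms(2) by simp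
    show "(F ^^ t) x (i - int k) = 0" if "t \<le> c + k * h + p" for t
      using K[OF \<open>K \<le> k\<close>] that by simp
  qed
  moreover obtain t j where "j < i - int K" "(F ^^ t) x j \<noteq> 0"
    using left_edge_unbounded[OF spr assms(5)] by blast
  moreover have "j = i - int (nat (i - j))" "K \<le> nat (i - j)"
    using \<open>j < i - int K\<close> by auto
  ultimately show False by metis
qed

end
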